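(* Let $\pi$ be a fixed permutation pattern. Every set $X$ of $n$ points in the plane in general position that avoids $\pi$ admits a manhattan network of linear complexity, i.e.\ $\mathsf{OPT^M}(X)=O(n)$, where the constant depends only on $\pi$.
   Context: General position: no two points share an $x$-coordinate or a $y$-coordinate. A point set in general position determines a permutation (the ranks of the $x$-coordinates listed in order of increasing $y$-coordinate); $X$ avoids a permutation $\pi$ of $[k]$ if no $k$ points of $X$ have relative ordering $\pi$. A manhattan path between points $x,y$ with respect to a point set $B$ is a sequence of distinct points $(x=x_1,\dots,x_k=y)$ of $B$ such that consecutive points lie on a common horizontal or vertical line and both the $x$-coordinates and the $y$-coordinates form monotone sequences. A manhattan network for $X$ is a point set $Y\supseteq X$ such that every two points of $X$ are joined by a manhattan path with respect to $Y$; its complexity is $|Y|$, and $\mathsf{OPT^M}(X)$ is the minimum complexity. *)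

theory Defs
  imports Complex_Main "HOL-Combinatorics.Permutations"
begin

type_synonym point = "real \<times> real"

definition general_position :: "point set \<Rightarrow> bool" where
  "general_position X \<longleftrightarrow> inj_on fst X \<and> inj_on snd X"

text \<open>Ranks are counted from 1.\<close>

definition x_rank :: "point set \<Rightarrow> point \<Rightarrow> nat" where
  "x_rank S p = card {q \<in> S. fst q \<le> fst p}"

definition y_rank :: "point set \<Rightarrow> point \<Rightarrow> nat" where
  "y_rank S p = card {q \<in> S. snd q \<le> snd p}"

text \<open>
  Listing the points of S by increasing y-coordinate, the i-th entry of the permutation is the
  x-rank of the point whose y-rank is i.  The length k is a separate argument because a function
  that permutes {1..k} also permutes {1..m} for every m > k, so it does not determine k.
\<close>

definition relative_ordering :: "point set \<Rightarrow> nat \<Rightarrow> (nat \<Rightarrow> nat) \<Rightarrow> bool" where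
  "relative_ordering S k \<pi> \<longleftrightarrow>
     finite S \<and> card S = k \<and> (\<forall>p\<in>S. \<pi> (y_rank S p) = x_rank S p)"

definition avoids :: "point set \<Rightarrow> nat \<Rightarrow> (nat \<Rightarrow> nat) \<Rightarrow> bool" where
  "avoids X k \<pi> \<longleftrightarrow> \<not> (\<exists>S\<subseteq>X. relative_ordering S k \<pi>)"

text \<open>
  Monotonicity is weak, and the two coordinates may be monotone in opposite directions.
\<close>

definition monotone_list :: "real list \<Rightarrow> bool" where
  "monotone_list xs \<longleftrightarrow> sorted_wrt (\<le>) xs \<or> sorted_wrt (\<ge>) xs"

definition manhattan_path :: "point set \<Rightarrow> point \<Rightarrow> point \<Rightarrow> point list \<Rightarrow> bool" where
  "manhattan_path B x y ps \<longleftrightarrow>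
     ps \<noteq> [] \<and> hd ps = x \<and> last ps = y \<and> distinct ps \<and> set ps \<subseteq> B \<and>
     successively (\<lambda>p q. fst p = fst q \<or> snd p = snd q) ps \<and>
     monotone_list (map fst ps) \<and> monotone_list (map snd ps)"

text \<open>
  Networks are finite by definition, so that \<^const>\<open>card\<close> really measures their size
  (the cardinality of an infinite set is 0).
\<close>

definition manhattan_network :: "point set \<Rightarrow> point set \<Rightarrow> bool" where
  "manhattan_network X Y \<longleftrightarrow>
     finite Y \<and> X \<subseteq> Y \<and> (\<forall>x\<in>X. \<forall>y\<in>X. \<exists>ps. manhattan_path Y x y ps)"

definition opt_manhattan :: "point set \<Rightarrow> nat" where
  "opt_manhattan X = (LEAST m. \<exists>Y. manhattan_network X Y \<and> card Y = m)"

end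

theory Submission
  imports Defs
begin

text \<open>
  Cut the plane into columns and rows, at first one per point, and merge adjacent columns or rows
  until one column or row remains.  Keep two invariants: every point is joined by monotone paths to
  the four corners of its cell, and any two points in a common column or row are joined.  If two
  adjacent columns are merged, both invariants survive after adding the intersections of the four
  column boundaries with the boundaries of the rows that meet these columns in a point; a path
  between points of the two columns runs through one corner of each of their cells.  By the
  Marcus--Tardos theorem there are only linearly many nonempty cells, so when the larger of the two
  families is merged, some adjacent pair has a bounded number of them.
  Hence each of the fewer than 2n merges costs O(1) points.
\<close>

subsection \<open>The Marcus--Tardos theorem\<close>

text \<open>Matrix entries are pairs (column, row), and \<open>\<pi>\<close> sends row positions to
  column positions, which matches the convention of \<open>relative_ordering\<close>.\<close>

definition contains_perm :: "nat \<Rightarrow> (nat \<Rightarrow> nat) \<Rightarrow> (nat \<times> nat) set \<Rightarrow> bool" where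
  "contains_perm k \<pi> M \<longleftrightarrow>
     (\<exists>c r. strict_mono_on {1..k} c \<and> strict_mono_on {1..k} r \<and> (\<forall>i\<in>{1..k}. (c (\<pi> i), r i) \<in> M))"

lemma contains_perm_image:
  assumes "contains_perm k \<pi> ((\<lambda>x. (f x, g x)) ` A)"
  obtains z c r where "strict_mono_on {1..k} c" "strict_mono_on {1..k} r"
    "\<And>i. i \<in> {1..k} \<Longrightarrow> z i \<in> A \<and> f (z i) = c (\<pi> i) \<and> g (z i) = r i"
proof -
  obtain c r where cr: "strict_mono_on {1..k} c" "strict_mono_on {1..k} r"
    "\<forall>i\<in>{1..k}. (c (\<pi> i), r i) \<in> (\<lambda>x. (f x, g x)) ` A"
    using assms unfolding contains_perm_def by blast
  have "\<forall>i\<in>{1..k}. \<exists>z. z \<in> A \<and> f z = c (\<pi> i) \<and> g z = r i"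
    using cr(3) by (fastforce simp del: atLeastAtMost_iff)
  then obtain z where "\<forall>i\<in>{1..k}. z i \<in> A \<and> f (z i) = c (\<pi> i) \<and> g (z i) = r i"
    by metis
  with cr that show ?thesis by blast
qed

text \<open>One entry is chosen from each block of the pattern. Different block columns or block
  rows are ordered like everything inside them, so the chosen entries form the same pattern.\<close>

lemma contains_perm_contract:
  assumes \<pi>: "\<pi> permutes {1..k}"
    and con: "contains_perm k \<pi> ((\<lambda>x. (fst x div s, snd x div s)) ` M)"
  shows "contains_perm k \<pi> M"
proof -
  obtain z c r where z: "strict_mono_on {1..k} c" "strict_mono_on {1..k} r"
    "\<And>i. i \<in> {1..k} \<Longrightarrow> z i \<in> M \<and> fst (z i) div s = c (\<pi> i) \<and> snd (z i) div s = r i"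
    using contains_perm_image[OF con] by metis
  have lt: "a < b" if "a div s < b div s" for a b :: nat
    using that by (meson div_le_mono not_less)
  \<comment> \<open>The entries \<open>z\<close> are indexed by rows; listing their columns in
    increasing order needs \<open>inv \<pi>\<close>.\<close>
  let ?c = "\<lambda>j. fst (z (inv \<pi> j))"
  have inv: "inv \<pi> j \<in> {1..k}" if "j \<in> {1..k}" for j
    using \<pi> that by (meson permutes_in_image permutes_inv)
  have "?c j div s = c j" if "j \<in> {1..k}" for j
    using z(3)[OF inv[OF that]] permutes_inverses(1)[OF \<pi>] by simp
  then have "?c i < ?c j" if "i \<in> {1..k}" "j \<in> {1..k}" "i < j" for i j
    using lt[of "?c i" "?c j"] strict_mono_onD[OF z(1) that] that by simp
  then have c: "strict_mono_on {1..k} ?c"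
    by (rule strict_mono_onI)
  have "snd (z i) < snd (z j)" if "i \<in> {1..k}" "j \<in> {1..k}" "i < j" for i j
    using lt[of "snd (z i)" "snd (z j)"] strict_mono_onD[OF z(2) that] z(3) that by simp
  then have r: "strict_mono_on {1..k} (\<lambda>i. snd (z i))"
    by (rule strict_mono_onI)
  have "\<forall>i\<in>{1..k}. (?c (\<pi> i), snd (z i)) \<in> M"
    using z(3) permutes_inverses(2)[OF \<pi>] by simp
  with c r show ?thesis
    unfolding contains_perm_def by blast
qed

text \<open>Transposing a matrix inverts the pattern; this turns tall blocks into wide ones.\<close>

lemma contains_perm_swap:
  assumes \<pi>: "\<pi> permutes {1..k}" and con: "contains_perm k (inv \<pi>) (prod.swap ` M)"
  shows "contains_perm k \<pi> M"
proof -
  obtain c r where cr: "strict_mono_on {1..k} c" "strict_mono_on {1..k} r"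
    "\<And>i. i \<in> {1..k} \<Longrightarrow> (c (inv \<pi> i), r i) \<in> prod.swap ` M"
    using con unfolding contains_perm_def by blast
  have "(r (\<pi> i), c i) \<in> M" if "i \<in> {1..k}" for i
  proof -
    have "\<pi> i \<in> {1..k}" using \<pi> that by (meson permutes_in_image)
    from cr(3)[OF this] show ?thesis using permutes_inverses(2)[OF \<pi>] by auto
  qed
  with cr show ?thesis unfolding contains_perm_def by blast
qed

lemma strict_mono_enumeration:
  fixes A :: "nat set"
  assumes "finite A" "k \<le> card A"
  obtains e where "strict_mono_on {1..k} e" "\<And>i. i \<in> {1..k} \<Longrightarrow> e i \<in> A"
proof -
  let ?xs = "sorted_list_of_set A"
  \<comment> \<open>Pattern positions start at 1, list positions at 0.\<close>
  let ?e = "\<lambda>i. ?xs ! (i - 1)"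
  have len: "length ?xs = card A" by simp
  have "strict_mono_on {1..k} ?e"
    using assms len
    by (intro strict_mono_onI) (auto intro!: sorted_wrt_nth_less[OF strict_sorted_list_of_set])
  moreover have "?e i \<in> A" if "i \<in> {1..k}" for i
    using that assms len nth_mem[of "i - 1" ?xs] by auto
  ultimately show ?thesis using that by blast
qed

section \<open>Contracting square blocks\<close>

definition block :: "(nat \<times> nat) set \<Rightarrow> nat \<Rightarrow> nat \<times> nat \<Rightarrow> (nat \<times> nat) set" where
  "block M s b = {x \<in> M. (fst x div s, snd x div s) = b}"

lemma block_subset:
  assumes "s > 0"
  shows "block M s (I, J) \<subseteq> {I * s..<I * s + s} \<times> {J * s..<J * s + s}"
  using dividend_less_div_times[OF assms] by (auto simp: block_def add.commute)

lemma finite_block: "s > 0 \<Longrightarrow> finite (block M s b)"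
  by (cases b) (auto intro: finite_subset[OF block_subset])

text \<open>For k = 0 every pair qualifies, even one whose block is empty; hence the counts below
  are for subsets of a bounded grid.\<close>

definition wide_blocks :: "(nat \<times> nat) set \<Rightarrow> nat \<Rightarrow> nat \<Rightarrow> (nat \<times> nat) set" where
  "wide_blocks M s k = {b. k \<le> card (fst ` block M s b)}"

text \<open>
  More than k * 2^s wide blocks in one block column would, by pigeonhole, include k blocks that
  occupy the same k columns; these contain every permutation of length k.
\<close>

lemma card_wide_blocks_column:
  assumes \<pi>: "\<pi> permutes {1..k}" and av: "\<not> contains_perm k \<pi> M"
    and s: "s > 0" and fin: "finite V" and wide: "\<And>J. J \<in> V \<Longrightarrow> (I, J) \<in> wide_blocks M s k"
  shows "card V \<le> k * 2 ^ s"
proof (rule ccontr)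
  assume big: "\<not> card V \<le> k * 2 ^ s"
  define cols where "cols J = fst ` block M s (I, J)" for J
  define P where "P = Pow {I * s..<I * s + s}"
  have finP: "finite P" and cardP: "card P = 2 ^ s"
    by (simp_all add: P_def card_Pow)
  have colsP: "cols ` V \<subseteq> P"
    using block_subset[OF s, of M I] by (fastforce simp: cols_def P_def)
  \<comment> \<open>The blocks of \<open>V\<close> are grouped by the set of columns they occupy;
    there are only 2^s such sets.\<close>
  have "card V = (\<Sum>A\<in>P. card {J \<in> V. cols J = A})"
    using sum.group[OF fin finP colsP, of "\<lambda>_. 1::nat"] by simp
  with big have "\<not> (\<Sum>A\<in>P. card {J \<in> V. cols J = A}) \<le> card P * k"
    by (simp add: cardP mult.commute)
  then obtain A where A: "A \<in> P" "k < card {J \<in> V. cols J = A}"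
    using sum_bounded_above[of P "\<lambda>A. card {J \<in> V. cols J = A}" k] by (force simp: not_le)
  have finA: "finite A" using A(1) by (auto simp: P_def intro: finite_subset)
  obtain J where "J \<in> V" "cols J = A"
    using A(2) by (metis (mono_tags, lifting) card.empty empty_Collect_eq less_nat_zero_code)
  then have "k \<le> card A"
    using wide by (auto simp: wide_blocks_def cols_def)
  then obtain c where c: "strict_mono_on {1..k} c" "\<And>i. i \<in> {1..k} \<Longrightarrow> c i \<in> A"
    using strict_mono_enumeration finA by metis
  obtain e where e: "strict_mono_on {1..k} e" "\<And>i. i \<in> {1..k} \<Longrightarrow> e i \<in> {J \<in> V. cols J = A}"
    using strict_mono_enumeration[of "{J \<in> V. cols J = A}" k] fin A(2) by auto
  \<comment> \<open>The i-th chosen block occupies all columns of \<open>A\<close>, in particular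
    the one the pattern asks for in its row i.\<close>
  have "\<exists>v. v div s = e i \<and> (c (\<pi> i), v) \<in> M" if "i \<in> {1..k}" for i
  proof -
    have "\<pi> i \<in> {1..k}" using \<pi> that by (meson permutes_in_image)
    then have "c (\<pi> i) \<in> cols (e i)" using c(2) e(2)[OF that] by auto
    then show ?thesis by (auto simp: cols_def block_def)
  qed
  then obtain v where v: "\<And>i. i \<in> {1..k} \<Longrightarrow> v i div s = e i \<and> (c (\<pi> i), v i) \<in> M"
    by metis
  have "strict_mono_on {1..k} v"
  proof (rule strict_mono_onI)
    fix i j assume "i \<in> {1..k}" "j \<in> {1..k}" "i < j"
    then have "v i div s < v j div s" using v e(1) by (simp add: strict_mono_onD)
    then show "v i < v j" by (meson div_le_mono not_less)
  qed
  with c(1) v av show False unfolding contains_perm_def by blast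
qed

lemma card_wide_blocks:
  assumes \<pi>: "\<pi> permutes {1..k}" and av: "\<not> contains_perm k \<pi> M"
    and s: "s > 0" and N: "N \<subseteq> {..<m} \<times> {..<m}" and wide: "N \<subseteq> wide_blocks M s k"
  shows "card N \<le> m * (k * 2 ^ s)"
proof -
  have fin: "finite {J. (I, J) \<in> N}" for I
    by (rule finite_subset[of _ "{..<m}"]) (use N in auto)
  have "N = (SIGMA I:{..<m}. {J. (I, J) \<in> N})" using N by auto
  then have "card N = (\<Sum>I<m. card {J. (I, J) \<in> N})"
    using card_SigmaI[of "{..<m}" "\<lambda>I. {J. (I, J) \<in> N}"] fin by simp
  also have "\<dots> \<le> (\<Sum>I<m. k * 2 ^ s)"
    using wide by (intro sum_mono card_wide_blocks_column[OF \<pi> av s fin]) auto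
  finally show ?thesis by simp
qed

lemma block_swap: "block (prod.swap ` M) s (prod.swap b) = prod.swap ` block M s b"
  by (cases b) (auto simp: block_def image_iff)

text \<open>Few blocks are wide or tall, and each has at most s^2 entries. Any other block lies in a
  product of at most k rows and k columns, so it has at most k^2 entries.\<close>

lemma card_contraction_step:
  assumes \<pi>: "\<pi> permutes {1..k}" and av: "\<not> contains_perm k \<pi> M"
    and s: "s > 0" and fin: "finite M"
    and N_def: "N = (\<lambda>x. (fst x div s, snd x div s)) ` M" and N: "N \<subseteq> {..<m} \<times> {..<m}"
  shows "card M \<le> k^2 * card N + m * (2 * k * 2 ^ s * s^2)"
proof -
  define W where "W = N \<inter> wide_blocks M s k"
  \<comment> \<open>The tall blocks, obtained as wide blocks of the transposed matrix.\<close>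
  define T where "T = N \<inter> prod.swap ` wide_blocks (prod.swap ` M) s k"
  have finN: "finite N" using fin N_def by simp
  have W: "card W \<le> m * (k * 2 ^ s)"
    using N by (intro card_wide_blocks[OF \<pi> av s]) (auto simp: W_def)
  have av': "\<not> contains_perm k (inv \<pi>) (prod.swap ` M)"
    using av contains_perm_swap[OF \<pi>] by blast
  have "card (prod.swap ` T) \<le> m * (k * 2 ^ s)"
    using N by (intro card_wide_blocks[OF permutes_inv[OF \<pi>] av' s]) (auto simp: T_def)
  then have T: "card T \<le> m * (k * 2 ^ s)"
    by (simp add: card_image)
  \<comment> \<open>A block that is both wide and tall is charged twice, which makes the sum split
    cleanly.\<close>
  have block_le: "card (block M s b) \<le> k^2 + (if b \<in> W then s^2 else 0) + (if b \<in> T then s^2 else 0)"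
    if b: "b \<in> N" for b
  proof (cases "b \<in> W \<or> b \<in> T")
    case True
    obtain I J where IJ: "b = (I, J)" by (cases b)
    have "card (block M s b) \<le> card ({I * s..<I * s + s} \<times> {J * s..<J * s + s})"
      unfolding IJ by (intro card_mono block_subset[OF s]) auto
    also have "\<dots> = s^2" by (simp add: card_cartesian_product power2_eq_square)
    finally show ?thesis using True by auto
  next
    case False
    have 1: "card (fst ` block M s b) \<le> k"
      using False b by (auto simp: W_def wide_blocks_def)
    have "prod.swap b \<notin> wide_blocks (prod.swap ` M) s k"
      using False b image_eqI[of b prod.swap "prod.swap b"] by (auto simp: T_def)
    then have 2: "card (snd ` block M s b) \<le> k"
      by (auto simp: wide_blocks_def block_swap image_image)
    have "card (block M s b) \<le> card (fst ` block M s b \<times> snd ` block M s b)"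
      using finite_block[OF s, of M b] by (intro card_mono) force+
    also have "\<dots> \<le> k^2"
      using mult_mono[OF 1 2] by (simp add: card_cartesian_product power2_eq_square)
    finally show ?thesis by simp
  qed
  have "M = (\<Union>b\<in>N. block M s b)"
    by (auto simp: N_def block_def)
  then have "card M \<le> (\<Sum>b\<in>N. card (block M s b))"
    using card_UN_le[OF finN, of "block M s"] by simp
  also have "\<dots> \<le> (\<Sum>b\<in>N. k^2 + (if b \<in> W then s^2 else 0) + (if b \<in> T then s^2 else 0))"
    by (intro sum_mono block_le)
  also have "\<dots> = k^2 * card N + card W * s^2 + card T * s^2"
    using finN by (simp add: sum.distrib sum.If_cases W_def T_def Int_commute Int_left_commute)
  also have "\<dots> \<le> k^2 * card N + m * (k * 2 ^ s) * s^2 + m * (k * 2 ^ s) * s^2"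
    using W T by (intro add_mono mult_mono) auto
  finally show ?thesis by (simp add: algebra_simps)
qed

text \<open>Strong induction on \<open>n\<close>: contraction yields a matrix of side about n / s
  that still avoids the pattern. For k = 0 the empty pattern occurs in every matrix.\<close>

theorem marcus_tardos:
  assumes \<pi>: "\<pi> permutes {1..k}"
  shows "\<exists>C. \<forall>n M. M \<subseteq> {..<n} \<times> {..<n} \<and> \<not> contains_perm k \<pi> M \<longrightarrow> card M \<le> C * n"
proof (cases "k = 0")
  case True
  then have "contains_perm k \<pi> M" for M
    by (auto simp: contains_perm_def strict_mono_on_def)
  then show ?thesis by blast
next
  case False
  \<comment> \<open>A non-wide, non-tall block has at most k^2 = s / 2 entries, so contracting s-by-s blocks
    multiplies the linear constant by roughly 1/2, which leaves room for the error term.\<close>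
  define s where "s = 2 * k^2"
  define D where "D = 2 * k * 2 ^ s * s^2"
  \<comment> \<open>The summand 4 * s settles the base case n < 4 * s, where n * n entries are at
    most C * n; the summand 3 * D gives 8 * D \<le> 3 * C.\<close>
  define C where "C = 3 * D + 4 * s"
  have s: "s > 0" "s \<ge> 2" using False by (auto simp: s_def)
  have "card M \<le> C * n" if "M \<subseteq> {..<n} \<times> {..<n}" "\<not> contains_perm k \<pi> M" for n M
    using that
  proof (induction n arbitrary: M rule: less_induct)
    case (less n)
    have fin: "finite M" using less.prems(1) by (rule finite_subset) simp
    show ?case
    proof (cases "n < 4 * s")
      case True
      have "card M \<le> card ({..<n} \<times> {..<n})"
        using less.prems(1) by (intro card_mono) auto
      also have "\<dots> = n * n" by (simp add: card_cartesian_product)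
      also have "\<dots> \<le> C * n" using True by (intro mult_right_mono) (auto simp: C_def)
      finally show ?thesis .
    next
      case False
      \<comment> \<open>The extra 1 accounts for an incomplete last block.\<close>
      define m where "m = n div s + 1"
      define N where "N = (\<lambda>x. (fst x div s, snd x div s)) ` M"
      have sm: "s * m \<le> n + s" by (simp add: m_def algebra_simps)
      have "2 * m \<le> s * m" using s by (intro mult_right_mono) auto
      with sm False s have mn: "m < n" by linarith
      \<comment> \<open>Here 2 * k^2 = s, and 4 * s * m \<le> 4 * n + 4 * s \<le> 5 * n.\<close>
      have "4 * (2 * (k^2 * m)) \<le> 5 * n"
        using sm False by (simp add: s_def algebra_simps)
      then have km: "8 * (k^2 * m) \<le> 5 * n" by simp
      have N: "N \<subseteq> {..<m} \<times> {..<m}"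
      proof -
        have "a div s < m" if "a < n" for a
          using that div_le_mono[of a n s] by (simp add: m_def)
        then show ?thesis using less.prems(1) by (auto simp: N_def)
      qed
      have "\<not> contains_perm k \<pi> N"
        using contains_perm_contract[OF \<pi>] less.prems(2) unfolding N_def by blast
      with less.IH[OF mn N] have IH: "card N \<le> C * m" by blast
      have "card M \<le> k^2 * card N + m * D"
        using card_contraction_step[OF \<pi> less.prems(2) s(1) fin N_def N] by (simp add: D_def)
      also have "\<dots> \<le> k^2 * (C * m) + n * D"
        using IH mn by (intro add_mono mult_mono) auto
      \<comment> \<open>Scaling by 8 avoids fractions: the contracted matrix takes 5/8 of C * n, the
        error term 3/8.\<close>
      finally have "8 * card M \<le> C * (8 * (k^2 * m)) + 8 * D * n"
        by (simp add: algebra_simps)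
      also have "\<dots> \<le> C * (5 * n) + (3 * C) * n"
        by (intro add_mono mult_left_mono mult_right_mono km) (auto simp: C_def)
      finally show ?thesis by simp
    qed
  qed
  then show ?thesis by blast
qed

subsection \<open>Merging columns and rows\<close>

definition steps :: "point set \<Rightarrow> (real \<Rightarrow> real \<Rightarrow> bool) \<Rightarrow> (real \<Rightarrow> real \<Rightarrow> bool) \<Rightarrow> point \<Rightarrow> point \<Rightarrow> bool" where
  "steps Y dx dy p q \<longleftrightarrow> p \<in> Y \<and> q \<in> Y \<and> (fst p = fst q \<or> snd p = snd q) \<and>
     dx (fst p) (fst q) \<and> dy (snd p) (snd q)"

text \<open>A walk with one fixed direction per axis, so composing walks keeps them monotone. Steps
  may stay in place, and the empty walk exists even at points outside \<open>Y\<close>.\<close>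

abbreviation reach :: "point set \<Rightarrow> (real \<Rightarrow> real \<Rightarrow> bool) \<Rightarrow> (real \<Rightarrow> real \<Rightarrow> bool) \<Rightarrow> point \<Rightarrow> point \<Rightarrow> bool" where
  "reach Y dx dy \<equiv> (steps Y dx dy)\<^sup>*\<^sup>*"

lemma reach_mono: "reach Y dx dy p q \<Longrightarrow> Y \<subseteq> Y' \<Longrightarrow> reach Y' dx dy p q"
  by (erule rtranclp_mono[THEN predicate2D, rotated]) (auto simp: steps_def)

lemma reach_converse: "reach Y dx dy p q \<Longrightarrow> reach Y dx\<inverse>\<inverse> dy\<inverse>\<inverse> q p"
proof (induction rule: rtranclp_induct)
  case (step y z)
  then have "steps Y dx\<inverse>\<inverse> dy\<inverse>\<inverse> z y" by (auto simp: steps_def)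
  with step.IH show ?case by (rule converse_rtranclp_into_rtranclp[rotated])
qed simp

lemma reach_swap: "reach Y dx dy p q \<Longrightarrow> reach (prod.swap ` Y) dy dx (prod.swap p) (prod.swap q)"
proof (induction rule: rtranclp_induct)
  case (step y z)
  then have "steps (prod.swap ` Y) dy dx (prod.swap y) (prod.swap z)"
    by (auto simp: steps_def)
  with step.IH show ?case by (rule rtranclp.rtrancl_into_rtrancl)
qed simp

definition connected_in :: "point set \<Rightarrow> point \<Rightarrow> point \<Rightarrow> bool" where
  "connected_in Y p q \<longleftrightarrow> (\<exists>dx\<in>{(\<le>), (\<ge>)}. \<exists>dy\<in>{(\<le>), (\<ge>)}. reach Y dx dy p q)"

lemma converse_le_ge: "((\<le>) :: real \<Rightarrow> _)\<inverse>\<inverse> = (\<ge>)" "((\<ge>) :: real \<Rightarrow> _)\<inverse>\<inverse> = (\<le>)"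
  by auto

lemma connected_in_sym: "connected_in Y p q \<Longrightarrow> connected_in Y q p"
proof -
  assume "connected_in Y p q"
  then obtain dx dy where d: "dx \<in> {(\<le>), (\<ge>)}" "dy \<in> {(\<le>), (\<ge>)}" "reach Y dx dy p q"
    unfolding connected_in_def by blast
  have "d\<inverse>\<inverse> \<in> {(\<le>), (\<ge>)}" if "d \<in> {(\<le>), (\<ge>)}" for d :: "real \<Rightarrow> real \<Rightarrow> bool"
    using that converse_le_ge by (elim insertE emptyE) simp_all
  with d(1,2) reach_converse[OF d(3)] show ?thesis
    unfolding connected_in_def by blast
qed

lemma connected_in_mono: "connected_in Y p q \<Longrightarrow> Y \<subseteq> Y' \<Longrightarrow> connected_in Y' p q"
  unfolding connected_in_def by (meson reach_mono)

lemma connected_in_swap: "connected_in Y p q \<Longrightarrow> connected_in (prod.swap ` Y) (prod.swap p) (prod.swap q)"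
  unfolding connected_in_def by (meson reach_swap)

text \<open>Stationary steps are dropped and the others prepended. The induction keeps the lists
  sorted in the fixed directions \<open>dx\<close> and \<open>dy\<close>, which is stronger than
  \<open>monotone_list\<close> and excludes repetitions.\<close>

lemma reach_imp_manhattan_path:
  assumes dx: "dx \<in> {(\<le>), (\<ge>)}" and dy: "dy \<in> {(\<le>), (\<ge>)}"
    and "reach Y dx dy p q" and q: "q \<in> Y"
  shows "\<exists>ps. manhattan_path Y p q ps \<and> sorted_wrt dx (map fst ps) \<and> sorted_wrt dy (map snd ps)"
  using assms(3)
proof (induction rule: converse_rtranclp_induct)
  case base
  have "manhattan_path Y q q [q]" using q by (simp add: manhattan_path_def monotone_list_def)
  then show ?case by (intro exI[of _ "[q]"]) simp
next
  case (step p p')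
  then obtain ps where ps: "manhattan_path Y p' q ps" "sorted_wrt dx (map fst ps)" "sorted_wrt dy (map snd ps)"
    by blast
  show ?case
  proof (cases "p = p'")
    case False
    obtain qs where qs: "ps = p' # qs" using ps(1) by (cases ps) (auto simp: manhattan_path_def)
    have st: "p \<in> Y" "fst p = fst p' \<or> snd p = snd p'" "dx (fst p) (fst p')" "dy (snd p) (snd p')"
      using step.hyps(1) by (auto simp: steps_def)
    have "transp dx" "transp dy" "antisymp dx" "antisymp dy" using dx dy
      by (auto simp: transp_def antisymp_def)
    then have x: "dx (fst p) (fst z)" "dy (snd p) (snd z)" if "z \<in> set ps" for z
      using that ps(2,3) st unfolding qs by (auto dest: transpD)
    \<comment> \<open>Returning to \<open>p\<close> after \<open>p'\<close> would, by antisymmetry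
      in both coordinates, give p = p'.\<close>
    have "p \<notin> set ps"
    proof
      assume "p \<in> set ps"
      with False have "p \<in> set qs" by (auto simp: qs)
      then have "dx (fst p') (fst p)" "dy (snd p') (snd p)" using ps(2,3) by (auto simp: qs)
      with st \<open>antisymp dx\<close> \<open>antisymp dy\<close> False show False
        by (meson antisympD prod_eqI)
    qed
    have so: "sorted_wrt dx (map fst (p # ps))" "sorted_wrt dy (map snd (p # ps))"
      using x ps(2,3) by auto
    then have "monotone_list (map fst (p # ps))" "monotone_list (map snd (p # ps))"
      using dx dy by (auto simp: monotone_list_def)
    then have "manhattan_path Y p q (p # ps)"
      using ps(1) st \<open>p \<notin> set ps\<close> unfolding manhattan_path_def qs by simp
    with so show ?thesis by blast
  qed (use ps in blast)
qed

lemma connected_in_imp_manhattan_path: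
  "connected_in Y p q \<Longrightarrow> q \<in> Y \<Longrightarrow> \<exists>ps. manhattan_path Y p q ps"
  unfolding connected_in_def using reach_imp_manhattan_path by meson

section \<open>Slabs and their merging\<close>

text \<open>
  With h = fst these are the columns, with h = snd the rows; x lies in slab f x, and slabs may
  contain no point.
\<close>

definition slabs :: "(point \<Rightarrow> real) \<Rightarrow> point set \<Rightarrow> nat \<Rightarrow> (point \<Rightarrow> nat) \<Rightarrow> (nat \<Rightarrow> real) \<Rightarrow> (nat \<Rightarrow> real) \<Rightarrow> bool" where
  "slabs h X p f lo hi \<longleftrightarrow>
     (\<forall>x\<in>X. f x < p \<and> lo (f x) \<le> h x \<and> h x \<le> hi (f x)) \<and>
     (\<forall>i<p. lo i \<le> hi i) \<and> (\<forall>j<p. \<forall>i<j. hi i < lo j)"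

lemma slabs_less:
  assumes "slabs h X p f lo hi" "x \<in> X" "y \<in> X" "f x < f y"
  shows "h x < h y"
  using assms unfolding slabs_def by (meson le_less_trans less_le_trans)

text \<open>The sorted list of coordinates supplies both boundaries of each slab, and
  \<open>f\<close> is the position in it; injectivity makes its length
  \<open>card X\<close>.\<close>

lemma slabs_singletons:
  assumes "finite X" "inj_on h X"
  obtains f lo where "slabs h X (card X) f lo lo" "inj_on f X"
    "\<And>x. x \<in> X \<Longrightarrow> lo (f x) = h x"
proof -
  let ?xs = "sorted_list_of_set (h ` X)"
  have fin: "finite (h ` X)" using assms by simp
  have len: "length ?xs = card X" using assms by (simp add: card_image)
  have "\<forall>x\<in>X. \<exists>i. i < card X \<and> ?xs ! i = h x"
    using fin len by (metis image_eqI in_set_conv_nth set_sorted_list_of_set)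
  then obtain f where f: "\<And>x. x \<in> X \<Longrightarrow> f x < card X \<and> ?xs ! f x = h x"
    by metis
  have "slabs h X (card X) f ((!) ?xs) ((!) ?xs)"
    using f len sorted_wrt_nth_less[OF strict_sorted_list_of_set, of _ _ "h ` X"] by (auto simp: slabs_def)
  moreover have "inj_on f X" using f assms(2) by (metis inj_onI inj_onD)
  ultimately show ?thesis using that f by blast
qed

definition merge_label :: "nat \<Rightarrow> nat \<Rightarrow> nat" where
  "merge_label i j = (if j \<le> i then j else j - 1)"

text \<open>The merged slab keeps index \<open>i\<close>, running from \<open>lo i\<close> to
  \<open>hi (Suc i)\<close> and absorbing the gap between the two; later slabs move down by one
  index.\<close>

lemma slabs_merge:
  assumes "slabs h X p f lo hi" "Suc i < p"
  shows "slabs h X (p - 1) (merge_label i \<circ> f)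
    (\<lambda>j. if j \<le> i then lo j else lo (Suc j)) (\<lambda>j. if j < i then hi j else hi (Suc j))"
    (is "slabs h X _ _ ?lo ?hi")
proof -
  have 1: "lo j \<le> hi j" if "j < p" for j using assms(1) that by (auto simp: slabs_def)
  have 2: "hi j < lo l" if "l < p" "j < l" for j l using assms(1) that by (auto simp: slabs_def)
  have lo: "lo j \<le> lo l" if "l < p" "j \<le> l" for j l
    using 1[of j] 2[of l j] that by (cases "j = l") auto
  have hi: "hi j \<le> hi l" if "l < p" "j \<le> l" for j l
    using 1[of l] 2[of l j] that by (cases "j = l") auto
  have "?lo (merge_label i (f x)) \<le> h x \<and> h x \<le> ?hi (merge_label i (f x)) \<and> merge_label i (f x) < p - 1"
    if "x \<in> X" for x
  proof -
    have x: "f x < p" "lo (f x) \<le> h x" "h x \<le> hi (f x)" using assms(1) that by (auto simp: slabs_def)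
    consider "f x < i" | "f x = i" | "f x = Suc i" | "Suc i < f x" by linarith
    then show ?thesis
      using x assms(2) hi[of "Suc i" i] lo[of "Suc i" i]
      by cases (auto simp: merge_label_def)
  qed
  moreover have "?lo j \<le> ?hi j" if "j < p - 1" for j
  proof -
    have "Suc j < p" using that by simp
    then show ?thesis using 1[of j] 1[of "Suc j"] lo[of "Suc j" j] by auto
  qed
  moreover have "?hi j < ?lo l" if "l < p - 1" "j < l" for j l
    using 2 that by auto
  ultimately show ?thesis unfolding slabs_def comp_def by blast
qed

section \<open>Corners of cells\<close>

definition corners_reached :: "point set \<Rightarrow> point \<Rightarrow> real \<Rightarrow> real \<Rightarrow> real \<Rightarrow> real \<Rightarrow> bool" where
  "corners_reached Y x a b c d \<longleftrightarrow>
     reach Y (\<ge>) (\<ge>) x (a, c) \<and> reach Y (\<ge>) (\<le>) x (a, d) \<and>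
     reach Y (\<le>) (\<ge>) x (b, c) \<and> reach Y (\<le>) (\<le>) x (b, d)"

lemma corners_reached_mono:
  "corners_reached Y x a b c d \<Longrightarrow> Y \<subseteq> Y' \<Longrightarrow> corners_reached Y' x a b c d"
  unfolding corners_reached_def using reach_mono by blast

lemma corners_reached_swap:
  "corners_reached Y x a b c d \<Longrightarrow> corners_reached (prod.swap ` Y) (prod.swap x) c d a b"
  unfolding corners_reached_def using reach_swap[of Y _ _ x] by fastforce

text \<open>Each new corner lies on the same horizontal line as the old one and further outward, so
  one more step extends the old walk.\<close>

lemma corners_reached_widen:
  assumes "corners_reached Y x a b c d" "{a, b, a', b'} \<times> {c, d} \<subseteq> Y" "a' \<le> a" "b \<le> b'"
  shows "corners_reached Y x a' b' c d"
proof -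
  have "steps Y (\<ge>) dy (a, v) (a', v)" "steps Y (\<le>) dy (b, v) (b', v)"
    if "v \<in> {c, d}" "dy \<in> {(\<le>), (\<ge>)}" for v dy
    using assms that by (auto simp: steps_def)
  with assms(1) show ?thesis
    unfolding corners_reached_def by (meson insertI1 insertI2 rtranclp.rtrancl_into_rtrancl)
qed

text \<open>The walk leaves the cell of \<open>x\<close> at the right corner facing the row of
  \<open>y\<close>, goes vertically to the nearer horizontal boundary of the cell of
  \<open>y\<close>, then horizontally to its left corner there, and ends with the reversed corner
  walk of \<open>y\<close>.\<close>

lemma connected_in_across:
  assumes x: "corners_reached Y x a b c d" and y: "corners_reached Y y a' b' c' d'"
    and Y: "{b, a'} \<times> {c, d, c', d'} \<subseteq> Y" and "b \<le> a'" and sep: "d \<le> c' \<or> d' \<le> c"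
  shows "connected_in Y x y"
  using sep
proof
  assume "d \<le> c'"
  then have "steps Y (\<le>) (\<le>) (b, d) (b, c')" "steps Y (\<le>) (\<le>) (b, c') (a', c')"
    using assms by (auto simp: steps_def)
  moreover have "reach Y (\<le>) (\<le>) (a', c') y"
    using y reach_converse[of Y "(\<ge>)" "(\<ge>)" y] by (auto simp: corners_reached_def converse_le_ge)
  moreover have "reach Y (\<le>) (\<le>) x (b, d)" using x by (simp add: corners_reached_def)
  ultimately have "reach Y (\<le>) (\<le>) x y"
    by (meson rtranclp.rtrancl_into_rtrancl rtranclp_trans)
  then show ?thesis unfolding connected_in_def by blast
next
  assume "d' \<le> c"
  then have "steps Y (\<le>) (\<ge>) (b, c) (b, d')" "steps Y (\<le>) (\<ge>) (b, d') (a', d')"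
    using assms by (auto simp: steps_def)
  moreover have "reach Y (\<le>) (\<ge>) (a', d') y"
    using y reach_converse[of Y "(\<ge>)" "(\<le>)" y] by (auto simp: corners_reached_def converse_le_ge)
  moreover have "reach Y (\<le>) (\<ge>) x (b, c)" using x by (simp add: corners_reached_def)
  ultimately have "reach Y (\<le>) (\<ge>) x y"
    by (meson rtranclp.rtrancl_into_rtrancl rtranclp_trans)
  then show ?thesis unfolding connected_in_def by blast
qed

section \<open>The invariants and a single merge\<close>

text \<open>Corners are demanded only for cells that contain a point, which is what keeps the cost
  of a merge proportional to the occupied cells.\<close>

definition grid_network ::
  "point set \<Rightarrow> point set \<Rightarrow> nat \<Rightarrow> (point \<Rightarrow> nat) \<Rightarrow> (nat \<Rightarrow> real) \<Rightarrow> (nat \<Rightarrow> real) \<Rightarrow>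
     nat \<Rightarrow> (point \<Rightarrow> nat) \<Rightarrow> (nat \<Rightarrow> real) \<Rightarrow> (nat \<Rightarrow> real) \<Rightarrow> bool" where
  "grid_network X Y p f lo hi q g lo' hi' \<longleftrightarrow>
     finite Y \<and> X \<subseteq> Y \<and> slabs fst X p f lo hi \<and> slabs snd X q g lo' hi' \<and>
     (\<forall>x\<in>X. corners_reached Y x (lo (f x)) (hi (f x)) (lo' (g x)) (hi' (g x))) \<and>
     (\<forall>x\<in>X. \<forall>y\<in>X. f x = f y \<or> g x = g y \<longrightarrow> connected_in Y x y)"

lemma grid_network_swap:
  assumes "grid_network X Y p f lo hi q g lo' hi'"
  shows "grid_network (prod.swap ` X) (prod.swap ` Y) q (g \<circ> prod.swap) lo' hi' p (f \<circ> prod.swap) lo hi"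
  using assms unfolding grid_network_def slabs_def
  by (auto simp: corners_reached_swap[where x = "(a, b)" for a b, simplified]
      connected_in_swap[where p = "(a, b)" and q = "(a', b')" for a b a' b', simplified])

lemma manhattan_network_swap:
  assumes "manhattan_network X Y"
  shows "manhattan_network (prod.swap ` X) (prod.swap ` Y)"
proof -
  have "manhattan_path (prod.swap ` Y) (prod.swap x) (prod.swap y) (map prod.swap ps)"
    if "manhattan_path Y x y ps" for x y ps
    using that unfolding manhattan_path_def
    by (auto simp: hd_map last_map distinct_map successively_map comp_def elim: successively_mono
        intro: inj_on_subset[OF inj_swap])
  then show ?thesis using assms unfolding manhattan_network_def by (auto; blast)
qed

text \<open>Four vertical boundaries cross at most 2 * \<open>card R\<close> horizontal ones. These
  crossings extend the corner walks outward and link the points of the two columns.\<close>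

lemma grid_network_merge_columns:
  assumes G: "grid_network X Y p f lo hi q g lo' hi'" and i: "Suc i < p"
    and R: "finite R" "\<And>x. x \<in> X \<Longrightarrow> f x \<in> {i, Suc i} \<Longrightarrow> g x \<in> R"
  shows "\<exists>Y' f' l h. grid_network X Y' (p - 1) f' l h q g lo' hi' \<and> card Y' \<le> card Y + 8 * card R"
proof -
  let ?l = "\<lambda>j. if j \<le> i then lo j else lo (Suc j)"
  let ?h = "\<lambda>j. if j < i then hi j else hi (Suc j)"
  let ?f = "merge_label i \<circ> f"
  define U where "U = {lo i, hi i, lo (Suc i), hi (Suc i)}"
  define V where "V = (\<Union>r\<in>R. {lo' r, hi' r})"
  let ?Y = "Y \<union> U \<times> V"
  have fx: "finite Y" "X \<subseteq> Y" "slabs fst X p f lo hi" "slabs snd X q g lo' hi'"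
    and cor: "\<And>x. x \<in> X \<Longrightarrow> corners_reached Y x (lo (f x)) (hi (f x)) (lo' (g x)) (hi' (g x))"
    and con: "\<And>x y. x \<in> X \<Longrightarrow> y \<in> X \<Longrightarrow> f x = f y \<or> g x = g y \<Longrightarrow> connected_in Y x y"
    using G by (auto simp: grid_network_def)
  have ord: "lo i \<le> hi i" "hi i < lo (Suc i)" "lo (Suc i) \<le> hi (Suc i)"
    using fx(3) i by (auto simp: slabs_def)
  have UV: "U \<times> {lo' (g x), hi' (g x)} \<subseteq> ?Y" if "x \<in> X" "f x \<in> {i, Suc i}" for x
    using R(2)[OF that] by (auto simp: V_def)
  have "card U \<le> 4"
    unfolding U_def by (intro order_trans[OF card_insert_le_m1]) auto
  have "card V \<le> (\<Sum>r\<in>R. card {lo' r, hi' r})"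
    unfolding V_def by (rule card_UN_le[OF R(1)])
  also have "\<dots> \<le> (\<Sum>r\<in>R. 2)" by (intro sum_mono) (simp add: card_insert_if)
  finally have "card V \<le> 2 * card R" by simp
  with \<open>card U \<le> 4\<close> have "card (U \<times> V) \<le> 4 * (2 * card R)"
    unfolding card_cartesian_product by (rule mult_le_mono)
  then have card: "card ?Y \<le> card Y + 8 * card R"
    using card_Un_le[of Y "U \<times> V"] by linarith
  have fin: "finite ?Y" using fx(1) R(1) by (auto simp: U_def V_def)
  have cor': "corners_reached ?Y x (?l (?f x)) (?h (?f x)) (lo' (g x)) (hi' (g x))" if x: "x \<in> X" for x
  proof -
    have c: "corners_reached ?Y x (lo (f x)) (hi (f x)) (lo' (g x)) (hi' (g x))"
      using cor[OF x] by (rule corners_reached_mono) simp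
    consider "f x < i" | "f x \<in> {i, Suc i}" | "Suc i < f x" by fastforce
    then show ?thesis
    proof cases
      case 2
      then have "{lo (f x), hi (f x), lo i, hi (Suc i)} \<subseteq> U" by (auto simp: U_def)
      then have "{lo (f x), hi (f x), lo i, hi (Suc i)} \<times> {lo' (g x), hi' (g x)} \<subseteq> ?Y"
        using UV[OF x 2] by blast
      moreover have "lo i \<le> lo (f x)" "hi (f x) \<le> hi (Suc i)" using 2 ord by auto
      \<comment> \<open>Both old cells of a row extend to the merged cell: left corners move to
        \<open>lo i\<close>, right ones to \<open>hi (Suc i)\<close>.\<close>
      ultimately have "corners_reached ?Y x (lo i) (hi (Suc i)) (lo' (g x)) (hi' (g x))"
        by (rule corners_reached_widen[OF c])
      moreover have "?f x = i" using 2 by (auto simp: merge_label_def)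
      ultimately show ?thesis by simp
    next
      case 1
      then have "?f x = f x" by (simp add: merge_label_def)
      with c 1 show ?thesis by simp
    next
      case 3
      then have "\<not> ?f x \<le> i" "\<not> ?f x < i" "Suc (?f x) = f x" by (auto simp: merge_label_def)
      with c show ?thesis by (simp del: comp_apply)
    qed
  qed
  have across: "connected_in ?Y x y" if "x \<in> X" "y \<in> X" "f x = i" "f y = Suc i" "g x \<noteq> g y" for x y
  proof (rule connected_in_across)
    show "corners_reached ?Y x (lo i) (hi i) (lo' (g x)) (hi' (g x))"
      using corners_reached_mono[OF cor[OF that(1)]] that(3) by simp
    show "corners_reached ?Y y (lo (Suc i)) (hi (Suc i)) (lo' (g y)) (hi' (g y))"
      using corners_reached_mono[OF cor[OF that(2)]] that(4) by simp
    show "{hi i, lo (Suc i)} \<times> {lo' (g x), hi' (g x), lo' (g y), hi' (g y)} \<subseteq> ?Y"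
      using UV[of x] UV[of y] that by (auto simp: U_def)
    show "hi i \<le> lo (Suc i)" using ord by simp
    show "hi' (g x) \<le> lo' (g y) \<or> hi' (g y) \<le> lo' (g x)"
      using fx(4) that by (meson less_imp_le linorder_neqE_nat slabs_def)
  qed
  have con': "connected_in ?Y x y" if "x \<in> X" "y \<in> X" "?f x = ?f y \<or> g x = g y" for x y
  proof (cases "f x = f y \<or> g x = g y")
    case True
    then show ?thesis using con that connected_in_mono by blast
  next
    case False
    \<comment> \<open>Only the labels \<open>i\<close> and \<open>Suc i\<close> are newly
      identified.\<close>
    then have "f x = i \<and> f y = Suc i \<or> f y = i \<and> f x = Suc i"
      using that(3) by (auto simp: merge_label_def split: if_splits)
    then show ?thesis
      using across[of x y] connected_in_sym[OF across[of y x]] that(1,2) False by metis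
  qed
  have "grid_network X ?Y (p - 1) ?f ?l ?h q g lo' hi'"
    unfolding grid_network_def
    using fin fx slabs_merge[OF fx(3) i] cor' con' by auto
  with card show ?thesis by blast
qed

section \<open>Sparse pairs and forbidden patterns\<close>

text \<open>Averaging over the disjoint pairs (2t, 2t + 1). There are p div 2 of them, and p \<le> 3
  * (p div 2) for p \<ge> 2; equality at p = 3 explains the factor 3.\<close>

lemma sparse_adjacent_columns:
  fixes N :: "(nat \<times> nat) set"
  assumes "finite N" "card N \<le> C * p" "2 \<le> p"
  obtains i where "Suc i < p" "card {x \<in> N. fst x \<in> {i, Suc i}} \<le> 3 * C"
proof -
  let ?A = "\<lambda>t. {x \<in> N. fst x \<in> {2 * t, Suc (2 * t)}}"
  have "\<exists>t < p div 2. card (?A t) \<le> 3 * C"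
  proof (rule ccontr)
    assume "\<not> ?thesis"
    then have "(\<Sum>t<p div 2. 3 * C + 1) \<le> (\<Sum>t<p div 2. card (?A t))"
      by (intro sum_mono) (auto simp: not_le)
    also have "\<dots> = card (\<Union>t<p div 2. ?A t)"
    proof (rule card_UN_disjoint[symmetric])
      have "fst x div 2 = t" if "x \<in> ?A t" for x t using that by auto
      then show "\<forall>t\<in>{..<p div 2}. \<forall>u\<in>{..<p div 2}. t \<noteq> u \<longrightarrow> ?A t \<inter> ?A u = {}"
        by blast
    qed (use assms(1) in auto)
    also have "\<dots> \<le> card N"
      using assms(1) by (intro card_mono) auto
    also note assms(2)
    finally have "C * (3 * (p div 2)) + p div 2 \<le> C * p" by (simp add: algebra_simps)
    moreover have "C * p \<le> C * (3 * (p div 2))" using assms(3) by (intro mult_left_mono) auto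
    moreover have "p div 2 > 0" using assms(3) by auto
    ultimately show False by linarith
  qed
  then obtain t where "t < p div 2" "card (?A t) \<le> 3 * C"
    by blast
  then show ?thesis using that[of "2 * t"] by simp
qed

lemma card_relabel_strict_mono:
  fixes e :: "nat \<Rightarrow> real"
  assumes "strict_mono_on {1..k} e" "i \<in> {1..k}"
  shows "card {j \<in> {1..k}. e j \<le> e i} = i"
proof -
  have "{j \<in> {1..k}. e j \<le> e i} = {1..i}"
    using assms strict_mono_on_less_eq[OF assms(1)] by auto
  then show ?thesis by simp
qed

text \<open>One point is picked per entry of the pattern. Strictly increasing labels force strictly
  increasing coordinates, so the i-th point has y-rank i and x-rank \<open>\<pi> i\<close>.\<close>

lemma contains_perm_imp_not_avoids:
  assumes \<pi>: "\<pi> permutes {1..k}"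
    and f: "\<And>x y. x \<in> X \<Longrightarrow> y \<in> X \<Longrightarrow> f x < f y \<Longrightarrow> fst x < fst y"
    and g: "\<And>x y. x \<in> X \<Longrightarrow> y \<in> X \<Longrightarrow> g x < g y \<Longrightarrow> snd x < snd y"
    and con: "contains_perm k \<pi> ((\<lambda>x. (f x, g x)) ` X)"
  shows "\<not> avoids X k \<pi>"
proof -
  obtain z c r where z: "strict_mono_on {1..k} c" "strict_mono_on {1..k} r"
    "\<And>i. i \<in> {1..k} \<Longrightarrow> z i \<in> X \<and> f (z i) = c (\<pi> i) \<and> g (z i) = r i"
    using contains_perm_image[OF con] by metis
  have inv: "inv \<pi> j \<in> {1..k}" if "j \<in> {1..k}" for j
    using \<pi> that by (meson permutes_in_image permutes_inv)
  have \<pi>k: "\<pi> i \<in> {1..k}" if "i \<in> {1..k}" for i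
    using \<pi> that by (meson permutes_in_image)
  have y: "strict_mono_on {1..k} (\<lambda>i. snd (z i))"
    by (intro strict_mono_onI g) (use z in \<open>auto simp: strict_mono_onD\<close>)
  have x: "strict_mono_on {1..k} (\<lambda>j. fst (z (inv \<pi> j)))"
  proof (rule strict_mono_onI)
    fix i j assume ij: "i \<in> {1..k}" "j \<in> {1..k}" "i < j"
    then have "c (\<pi> (inv \<pi> i)) < c (\<pi> (inv \<pi> j))"
      using z(1) permutes_inverses(1)[OF \<pi>] by (simp add: strict_mono_onD)
    then show "fst (z (inv \<pi> i)) < fst (z (inv \<pi> j))"
      using ij inv z(3) by (intro f) auto
  qed
  define S where "S = z ` {1..k}"
  have inj: "inj_on z {1..k}"
    using strict_mono_on_imp_inj_on[OF y] by (intro inj_on_imageI2[of snd]) (simp add: comp_def)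
  have "relative_ordering S k \<pi>"
    unfolding relative_ordering_def
  proof (intro conjI ballI)
    show "finite S" "card S = k" using inj by (auto simp: S_def card_image)
    fix p assume "p \<in> S"
    then obtain i where i: "i \<in> {1..k}" "p = z i" by (auto simp: S_def)
    have "{q \<in> S. snd q \<le> snd p} = z ` {j \<in> {1..k}. snd (z j) \<le> snd (z i)}"
      using i by (auto simp: S_def)
    moreover have "inj_on z {j \<in> {1..k}. snd (z j) \<le> snd (z i)}"
      by (rule inj_on_subset[OF inj]) blast
    ultimately have 1: "y_rank S p = i"
      unfolding y_rank_def using card_relabel_strict_mono[OF y i(1)] by (simp only: card_image)
    \<comment> \<open>Reindexing by \<open>inv \<pi>\<close> lists the points of \<open>S\<close> by
      increasing x-coordinate, so the x-rank is read off as a position.\<close>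
    have "{q \<in> S. fst q \<le> fst p} = z ` inv \<pi> ` {j \<in> {1..k}. fst (z (inv \<pi> j)) \<le> fst (z (inv \<pi> (\<pi> i)))}"
      (is "_ = z ` inv \<pi> ` ?J")
    proof -
      have "{1..k} = inv \<pi> ` {1..k}" using permutes_image[OF permutes_inv[OF \<pi>]] by simp
      then have "S = z ` inv \<pi> ` {1..k}" by (simp add: S_def)
      then show ?thesis using i permutes_inverses(2)[OF \<pi>] by auto
    qed
    moreover have "inj_on z (inv \<pi> ` ?J)"
      by (rule inj_on_subset[OF inj]) (use inv in blast)
    moreover have "inj_on (inv \<pi>) ?J"
      by (rule permutes_inj_on[OF permutes_inv[OF \<pi>]])
    ultimately have 2: "x_rank S p = \<pi> i"
      unfolding x_rank_def using card_relabel_strict_mono[OF x \<pi>k[OF i(1)]] by (simp only: card_image)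
    show "\<pi> (y_rank S p) = x_rank S p" using 1 2 by simp
  qed
  moreover have "S \<subseteq> X" using z(3) by (auto simp: S_def)
  ultimately show ?thesis unfolding avoids_def by blast
qed

section \<open>Iterating the merges\<close>

text \<open>With a single column or row all points share a label, so the second invariant covers
  every pair.\<close>

lemma grid_network_imp_manhattan_network:
  assumes G: "grid_network X Y p f lo hi q g lo' hi'" and pq: "p \<le> 1 \<or> q \<le> 1"
  shows "manhattan_network X Y"
proof -
  have s: "slabs fst X p f lo hi" "slabs snd X q g lo' hi'" and fin: "finite Y" "X \<subseteq> Y"
    and con: "\<And>x y. x \<in> X \<Longrightarrow> y \<in> X \<Longrightarrow> f x = f y \<or> g x = g y \<Longrightarrow> connected_in Y x y"
    using G unfolding grid_network_def by blast+
  have lt: "f x < p" "g x < q" if "x \<in> X" for x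
    using s that by (simp_all add: slabs_def)
  have "connected_in Y x y" if "x \<in> X" "y \<in> X" for x y
  proof (rule con[OF that])
    show "f x = f y \<or> g x = g y" using lt[OF that(1)] lt[OF that(2)] pq by linarith
  qed
  with fin show ?thesis
    using connected_in_imp_manhattan_path unfolding manhattan_network_def by blast
qed

text \<open>All that the merging uses of pattern avoidance. It refers to every choice of slabs, so
  it survives merges, and it is symmetric under swapping axes, whereas avoidance would change to
  \<open>inv \<pi>\<close>.\<close>

definition sparse_grids :: "point set \<Rightarrow> nat \<Rightarrow> bool" where
  "sparse_grids X C \<longleftrightarrow> (\<forall>p f lo hi q g lo' hi'.
     slabs fst X p f lo hi \<and> slabs snd X q g lo' hi' \<longrightarrow>
       card ((\<lambda>x. (f x, g x)) ` X) \<le> C * max p q)"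

lemma sparse_grids_swap:
  assumes "sparse_grids X C"
  shows "sparse_grids (prod.swap ` X) C"
  unfolding sparse_grids_def
proof (intro allI impI)
  fix p f lo hi q g lo' hi'
  assume "slabs fst (prod.swap ` X) p f lo hi \<and> slabs snd (prod.swap ` X) q g lo' hi'"
  then have "slabs snd X p (f \<circ> prod.swap) lo hi" "slabs fst X q (g \<circ> prod.swap) lo' hi'"
    by (auto simp: slabs_def)
  with assms have "card ((\<lambda>x. ((g \<circ> prod.swap) x, (f \<circ> prod.swap) x)) ` X) \<le> C * max q p"
    unfolding sparse_grids_def by blast
  moreover have "(\<lambda>x. (f x, g x)) ` prod.swap ` X =
      prod.swap ` (\<lambda>x. ((g \<circ> prod.swap) x, (f \<circ> prod.swap) x)) ` X"
    by (simp add: image_image)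
  ultimately show "card ((\<lambda>x. (f x, g x)) ` prod.swap ` X) \<le> C * max p q"
    by (simp only: card_image[OF inj_swap] max.commute)
qed

text \<open>The occupied cells form a matrix that fits in a square of side \<open>max p q\<close>;
  the pattern in it would give the pattern in \<open>X\<close>.\<close>

lemma avoids_imp_sparse_grids:
  assumes \<pi>: "\<pi> permutes {1..k}"
  shows "\<exists>C. \<forall>X. avoids X k \<pi> \<longrightarrow> sparse_grids X C"
proof -
  obtain C where C: "\<And>n M. M \<subseteq> {..<n} \<times> {..<n} \<Longrightarrow> \<not> contains_perm k \<pi> M \<Longrightarrow> card M \<le> C * n"
    using marcus_tardos[OF \<pi>] by blast
  have "card ((\<lambda>x. (f x, g x)) ` X) \<le> C * max p q"
    if "avoids X k \<pi>" and s: "slabs fst X p f lo hi" "slabs snd X q g lo' hi'"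
    for X p f lo hi q g lo' hi'
  proof (rule C)
    show "(\<lambda>x. (f x, g x)) ` X \<subseteq> {..<max p q} \<times> {..<max p q}"
      using s by (auto simp: slabs_def less_max_iff_disj)
    show "\<not> contains_perm k \<pi> ((\<lambda>x. (f x, g x)) ` X)"
      using contains_perm_imp_not_avoids[OF \<pi>, of X f g] slabs_less[OF s(1)] slabs_less[OF s(2)] that(1)
      by blast
  qed
  then show ?thesis unfolding sparse_grids_def by blast
qed

text \<open>Since q \<le> p, the occupied cells number at most C * p, so some adjacent pair of
  columns meets at most 3 * C of them; merging it costs 8 * 3 * C points.\<close>

lemma grid_network_shrink:
  assumes sp: "sparse_grids X C" and G: "grid_network X Y p f lo hi q g lo' hi'"
    and p: "q \<le> p" "2 \<le> p"
  shows "\<exists>Y' f' l h. grid_network X Y' (p - 1) f' l h q g lo' hi' \<and> card Y' \<le> card Y + 24 * C"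
proof -
  let ?N = "(\<lambda>x. (f x, g x)) ` X"
  have "finite X" using G by (auto simp: grid_network_def intro: finite_subset)
  then have fin: "finite ?N" by simp
  have "card ?N \<le> C * max p q"
    using sp G unfolding sparse_grids_def grid_network_def by blast
  then have "card ?N \<le> C * p" using p by (simp add: max_def)
  then obtain i where i: "Suc i < p" "card {x \<in> ?N. fst x \<in> {i, Suc i}} \<le> 3 * C"
    using sparse_adjacent_columns[OF fin _ p(2)] by blast
  let ?R = "snd ` {x \<in> ?N. fst x \<in> {i, Suc i}}"
  have "card ?R \<le> 3 * C"
    using i(2) card_image_le[of "{x \<in> ?N. fst x \<in> {i, Suc i}}" snd] fin by simp
  moreover have "finite ?R" using fin by simp
  moreover have "g x \<in> ?R" if "x \<in> X" "f x \<in> {i, Suc i}" for x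
    using that by (force simp: image_iff)
  ultimately show ?thesis
    using grid_network_merge_columns[OF G i(1), of ?R] by fastforce
qed

text \<open>Each merge lowers p + q by one at a cost of 24 * C. Rows are merged by swapping axes,
  hence the induction also generalizes \<open>X\<close>.\<close>

lemma grid_network_imp_small_manhattan_network:
  assumes "sparse_grids X C" and "grid_network X Y p f lo hi q g lo' hi'"
  shows "\<exists>Z. manhattan_network X Z \<and> card Z \<le> card Y + 24 * C * (p + q)"
  using assms
proof (induction "p + q" arbitrary: X Y p f lo hi q g lo' hi' rule: less_induct)
  case less
  note sp = less.prems(1) and G = less.prems(2)
  consider "p \<le> 1 \<or> q \<le> 1" | "q \<le> p" "2 \<le> p" | "p < q" "2 \<le> q" by linarith
  then show ?case
  proof cases
    case 1
    with grid_network_imp_manhattan_network[OF G] show ?thesis by (intro exI[of _ Y]) simp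
  next
    case 2
    obtain Y' f' l h where Y': "grid_network X Y' (p - 1) f' l h q g lo' hi'" "card Y' \<le> card Y + 24 * C"
      using grid_network_shrink[OF sp G 2] by blast
    obtain Z where Z: "manhattan_network X Z" "card Z \<le> card Y' + 24 * C * (p - 1 + q)"
      using less.hyps[OF _ sp Y'(1)] 2 by auto
    have "p + q = Suc (p - 1 + q)" using 2 by simp
    then have "24 * C * (p + q) = 24 * C + 24 * C * (p - 1 + q)" by (simp only: mult_Suc_right)
    then have "card Z \<le> card Y + 24 * C * (p + q)" using Z(2) Y'(2) by linarith
    with Z(1) show ?thesis by blast
  next
    case 3
    let ?X = "prod.swap ` X"
    note sp' = sparse_grids_swap[OF sp] and G' = grid_network_swap[OF G]
    obtain Y' f' l h where Y': "grid_network ?X Y' (q - 1) f' l h p (f \<circ> prod.swap) lo hi"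
      "card Y' \<le> card Y + 24 * C"
      using grid_network_shrink[OF sp' G'] 3 by (auto simp: card_image)
    obtain Z where Z: "manhattan_network ?X Z" "card Z \<le> card Y' + 24 * C * (q - 1 + p)"
    proof -
      have "q - 1 + p < p + q" using 3 by simp
      from less.hyps[OF this sp' Y'(1)] that show ?thesis by blast
    qed
    have "p + q = Suc (q - 1 + p)" using 3 by simp
    then have "24 * C * (p + q) = 24 * C + 24 * C * (q - 1 + p)" by (simp only: mult_Suc_right)
    then have "card (prod.swap ` Z) \<le> card Y + 24 * C * (p + q)"
      unfolding card_image[OF inj_swap] using Z(2) Y'(2) by linarith
    moreover have "manhattan_network X (prod.swap ` Z)"
      using manhattan_network_swap[OF Z(1)] by (simp add: image_image)
    ultimately show ?thesis by blast
  qed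
qed

text \<open>Every occupied cell is a single point coinciding with its four corners, and injective
  labels reduce the second invariant to x = y.\<close>

lemma grid_network_initial:
  assumes "finite X" "general_position X"
  obtains f lo g lo' where "grid_network X X (card X) f lo lo (card X) g lo' lo'"
proof -
  obtain f lo where f: "slabs fst X (card X) f lo lo" "inj_on f X" "\<And>x. x \<in> X \<Longrightarrow> lo (f x) = fst x"
    using slabs_singletons assms unfolding general_position_def by metis
  obtain g lo' where g: "slabs snd X (card X) g lo' lo'" "inj_on g X" "\<And>x. x \<in> X \<Longrightarrow> lo' (g x) = snd x"
    using slabs_singletons assms unfolding general_position_def by metis
  have "connected_in X x y" if "x \<in> X" "y \<in> X" "f x = f y \<or> g x = g y" for x y
    using that f(2) g(2) by (auto simp: inj_on_def connected_in_def)
  then have "grid_network X X (card X) f lo lo (card X) g lo' lo'"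
    using assms f g by (auto simp: grid_network_def corners_reached_def)
  with that show ?thesis by blast
qed

theorem theorem15:
  fixes k :: nat and \<pi> :: "nat \<Rightarrow> nat"
  assumes "\<pi> permutes {1..k}"
  shows "\<exists>c::real. \<forall>X::point set.
           finite X \<and> general_position X \<and> avoids X k \<pi> \<longrightarrow>
             (\<exists>Y. manhattan_network X Y \<and> real (card Y) \<le> c * real (card X)) \<and>
             real (opt_manhattan X) \<le> c * real (card X)"
proof -
  obtain C where C: "\<And>X. avoids X k \<pi> \<Longrightarrow> sparse_grids X C"
    using avoids_imp_sparse_grids[OF assms] by blast
  show ?thesis
  \<comment> \<open>The 1 pays for \<open>X\<close> itself, and 48 = 2 * 24 because merging starts
    from \<open>card X\<close> columns and \<open>card X\<close> rows.\<close>
  proof (intro exI[of _ "real (1 + 48 * C)"] allI impI)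
    fix X :: "point set"
    assume X: "finite X \<and> general_position X \<and> avoids X k \<pi>"
    then obtain f lo g lo' where "grid_network X X (card X) f lo lo (card X) g lo' lo'"
      using grid_network_initial by blast
    then obtain Y where Y: "manhattan_network X Y" "card Y \<le> card X + 24 * C * (card X + card X)"
      using grid_network_imp_small_manhattan_network C X by blast
    have "card Y \<le> (1 + 48 * C) * card X" using Y(2) by (simp add: algebra_simps)
    then have le: "real (card Y) \<le> real (1 + 48 * C) * real (card X)"
      unfolding of_nat_mult[symmetric] of_nat_le_iff .
    have "opt_manhattan X \<le> card Y"
      unfolding opt_manhattan_def using Y(1) by (intro Least_le) blast
    with le Y(1) show "(\<exists>Y. manhattan_network X Y \<and> real (card Y) \<le> real (1 + 48 * C) * real (card X)) \<and>
        real (opt_manhattan X) \<le> real (1 + 48 * C) * real (card X)"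
      by force
  qed
qed

end
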